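(* Let $P$ be the distribution of the binary random vector $X=(X_v)_{v\in V}$ of a discrete determinantal point process on a finite set $V$ with kernel $K$. Then the context-specific independence model $\mathcal{J}_{\cdot\mid X_C=1_C}(P)$ is (globally) Markov with respect to the undirected graph $G_u(P)$; that is, for all pairwise disjoint subsets $A,B,S$ of $V$ with $A,B$ non-empty ($S$ possibly empty), if every path in $G_u(P)$ between a vertex of $A$ and a vertex of $B$ contains a vertex of $S$, then $X_A$ and $X_B$ are independent in the context $X_S=1_S$.
   Context: Let $V$ be a finite set. A (discrete) determinantal point process (DPP) on $V$ with kernel $K$ is a random subset $Y$ of $V$ such that $\mathbb{P}(A\subseteq Y)=\det(K_A)$ for all non-empty $A\subseteq V$, where $K\in\mathbb{R}^{V\times V}$ is a (symmetric) positive definite matrix with all eigenvalues at most $1$, and $K_A$ is the principal submatrix of $K$ with rows and columns indexed by $A$. Equivalently, the DPP is the binary random vector $X=(X_v)_{v\in V}\in\{0,1\}^V$ with $X_v=1$ iff $v\in Y$. For $A\subseteq V$, $X_A=(X_v)_{v\in A}$, and $1_A$ is the all-ones vector indexed by $A$. $X_A$ and $X_B$ are independent in the context $X_C=1_C$ if they are independent under the conditional distribution $P(\cdot\mid X_C=1_C)$ (under $P$ itself if $C=\varnothing$). The context-specific independence model $\mathcal{J}_{\cdot\mid X_C=1_C}(P)$ is the set of all such statements, i.e. of all triples $\langle A,B\mid C\rangle$ of pairwise disjoint subsets of $V$ (with $C$ ranging over all subsets) such that $X_A$ and $X_B$ are independent in the context $X_C=1_C$. $G_u(P)$ is the undirected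 graph with node set $V$ in which distinct nodes $i$ and $j$ are non-adjacent if and only if $(K^{-1})_{ij}=0$. Endpoints of a path count as its vertices. *)

theory Defs
  imports "HOL-Analysis.Analysis" "HOL-Probability.Probability"
begin

text \<open>The ground set \<open>V\<close> is the universe of a finite type \<open>'v\<close>.\<close>

(* det (K_A), the principal minor on rows and columns A: this is the library's definition of det
   with UNIV replaced by A, since a subset A is not available as an index type.  The two lemmas
   below relate it to det. *)
definition principal_minor :: "real^'v::finite^'v \<Rightarrow> 'v set \<Rightarrow> real" where
  "principal_minor K A = (\<Sum>p | p permutes A. of_int (sign p) * (\<Prod>i\<in>A. K $ i $ p i))"

lemma principal_minor_UNIV: "principal_minor K UNIV = det K"
  by (simp add: principal_minor_def det_def)

lemma principal_minor_range:
  fixes K :: "real^'v::finite^'v" and f :: "'n::finite \<Rightarrow> 'v"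
  assumes "inj f"
  shows "principal_minor K (range f) = det (\<chi> i j. K $ f i $ f j)"
proof -
  let ?m = "map_permutation UNIV f"
  define g where "g = inv_into UNIV f"
  have bij: "bij_betw f UNIV (range f)" and bij': "bij_betw g (range f) UNIV"
    using assms by (auto simp: bij_betw_def g_def inj_on_inv_into)
  have gf: "g (f x) = x" for x using assms by (simp add: g_def)
  have fg: "f (g y) = y" if "y \<in> range f" for y using that by (simp add: g_def f_inv_into_f)
  have "(\<Sum>p | p permutes (UNIV :: 'n set). of_int (sign p) * (\<Prod>i\<in>UNIV. K $ f i $ f (p i))) =
        (\<Sum>q | q permutes range f. of_int (sign q) * (\<Prod>i\<in>range f. K $ i $ q i))"
  proof (rule sum.reindex_bij_witness[where i = "map_permutation (range f) g" and j = ?m])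
    fix p assume p: "p \<in> {p. p permutes (UNIV :: 'n set)}"
    show "map_permutation (range f) g (?m p) = p"
      using p gf by (intro map_permutation_compose_inv[OF bij]) auto
    show "?m p \<in> {q. q permutes range f}"
      using p map_permutation_permutes[OF bij] by blast
    show "of_int (sign (?m p)) * (\<Prod>i\<in>range f. K $ i $ ?m p i) =
          of_int (sign p) * (\<Prod>i\<in>UNIV. K $ f i $ f (p i))"
      using p assms
      by (subst sign_map_permutation) (auto simp: prod.reindex map_permutation_apply)
  next
    fix q assume q: "q \<in> {q. q permutes range f}"
    show "?m (map_permutation (range f) g q) = q"
      using q fg by (intro map_permutation_compose_inv[OF bij']) auto
    show "map_permutation (range f) g q \<in> {p. p permutes UNIV}"
      using q map_permutation_permutes[OF bij'] by blast
  qed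
  then show ?thesis
    by (simp add: principal_minor_def det_def)
qed

definition positive_definite :: "real^'n::finite^'n \<Rightarrow> bool" where
  "positive_definite K \<longleftrightarrow> transpose K = K \<and> (\<forall>x. x \<noteq> 0 \<longrightarrow> x \<bullet> (K *v x) > 0)"

definition eigenvalue :: "real^'n::finite^'n \<Rightarrow> real \<Rightarrow> bool" where
  "eigenvalue K c \<longleftrightarrow> (\<exists>x. x \<noteq> 0 \<and> K *v x = c *\<^sub>R x)"

definition dpp :: "'w measure \<Rightarrow> ('w \<Rightarrow> 'v::finite set) \<Rightarrow> real^'v^'v \<Rightarrow> bool" where
  "dpp M Y K \<longleftrightarrow>
     prob_space M \<and> Y \<in> measurable M (count_space UNIV) \<and>
     positive_definite K \<and> (\<forall>c. eigenvalue K c \<longrightarrow> c \<le> 1) \<and>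
     (\<forall>A. A \<noteq> {} \<longrightarrow> measure M {\<omega> \<in> space M. A \<subseteq> Y \<omega>} = principal_minor K A)"

text \<open>Binary vectors are functions \<open>'v \<Rightarrow> bool\<close>, with \<open>True\<close> for \<open>1\<close> and \<open>False\<close> for \<open>0\<close>.\<close>

definition binary_vector :: "('w \<Rightarrow> 'v set) \<Rightarrow> 'w \<Rightarrow> 'v \<Rightarrow> bool" where
  "binary_vector Y \<omega> v \<longleftrightarrow> v \<in> Y \<omega>"

(* The conditional distribution given X_C = 1_C.  It is meaningful only if this event has positive
   probability; for a DPP this always holds, as the kernel is positive definite. *)
definition context_measure :: "('v \<Rightarrow> bool) measure \<Rightarrow> 'v set \<Rightarrow> ('v \<Rightarrow> bool) measure" where
  "context_measure P C = uniform_measure P {x \<in> space P. \<forall>v\<in>C. x v}"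

lemma context_measure_empty:
  assumes "prob_space P"
  shows "context_measure P {} = P"
proof -
  interpret prob_space P by fact
  have "uniform_measure P (space P) = P"
    by (rule measure_eqI) (auto simp: emeasure_space_1 Int_absorb1 sets.sets_into_space divide_ennreal_def)
  then show ?thesis by (simp add: context_measure_def)
qed

definition csi_model :: "('v \<Rightarrow> bool) measure \<Rightarrow> ('v set \<times> 'v set \<times> 'v set) set" where
  "csi_model P = {(A, B, C). disjnt A B \<and> disjnt A C \<and> disjnt B C \<and>
     prob_space.indep_var (context_measure P C)
       (count_space UNIV) (\<lambda>x. restrict x A) (count_space UNIV) (\<lambda>x. restrict x B)}"

text \<open>An undirected graph with node set \<open>UNIV\<close> is given by its adjacency relation.\<close>

definition concentration_graph :: "real^'v::finite^'v \<Rightarrow> 'v \<Rightarrow> 'v \<Rightarrow> bool" where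
  "concentration_graph K i j \<longleftrightarrow> i \<noteq> j \<and> matrix_inv K $ i $ j \<noteq> 0"

definition graph_path :: "('v \<Rightarrow> 'v \<Rightarrow> bool) \<Rightarrow> 'v list \<Rightarrow> bool" where
  "graph_path E p \<longleftrightarrow> p \<noteq> [] \<and> distinct p \<and> successively E p"

definition separates :: "('v \<Rightarrow> 'v \<Rightarrow> bool) \<Rightarrow> 'v set \<Rightarrow> 'v set \<Rightarrow> 'v set \<Rightarrow> bool" where
  "separates E S A B \<longleftrightarrow>
     (\<forall>p. graph_path E p \<and> hd p \<in> A \<and> last p \<in> B \<longrightarrow> set p \<inter> S \<noteq> {})"

definition globally_markov ::
  "('v set \<times> 'v set \<times> 'v set) set \<Rightarrow> ('v \<Rightarrow> 'v \<Rightarrow> bool) \<Rightarrow> bool" where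
  "globally_markov J E \<longleftrightarrow>
     (\<forall>A B S. disjnt A B \<and> disjnt A S \<and> disjnt B S \<and> A \<noteq> {} \<and> B \<noteq> {} \<and> separates E S A B
        \<longrightarrow> (A, B, S) \<in> J)"

end

theory Submission
  imports Defs
begin

text \<open>
  Let \<open>Q\<close> be the inverse of \<open>K\<close>. Jacobi's identity \<open>det K\<^sub>D = det K \<cdot> det Q\<^bsub>V - D\<^esub>\<close> turns
  statements on inclusion probabilities into statements on principal minors of \<open>Q\<close>. If \<open>S\<close> separates
  \<open>A\<close> from \<open>B\<close>, then \<open>V - S\<close> splits into the part \<open>T\<close> reachable from \<open>A\<close> and a part \<open>U\<close> containing \<open>B\<close>,
  with no edge in between, so that \<open>Q\<close> is block diagonal on \<open>T \<union> U\<close> and its minors factorize.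
  Hence the events \<open>C \<subseteq> Y\<close> and \<open>D \<subseteq> Y\<close> with \<open>C \<subseteq> A\<close> and \<open>D \<subseteq> B\<close> are conditionally
  independent given \<open>S \<subseteq> Y\<close>, and these events generate the sigma-algebras of \<open>X\<^sub>A\<close> and \<open>X\<^sub>B\<close>.
\<close>

section \<open>Determinantal identities for principal minors\<close>

lemma principal_minor_cong:
  assumes "\<And>i j. i \<in> D \<Longrightarrow> j \<in> D \<Longrightarrow> K $ i $ j = L $ i $ j"
  shows "principal_minor K D = principal_minor L D"
  unfolding principal_minor_def
  using assms by (intro sum.cong prod.cong refl arg_cong2[where f = "(*)"]) (auto simp: permutes_in_image)

lemma principal_minor_empty [simp]: "principal_minor K {} = 1"
  by (simp add: principal_minor_def permutes_empty sign_id)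

text \<open>Every column outside \<open>D\<close> is a unit vector, so in the Leibniz sum only
  permutations fixing all points outside \<open>D\<close> survive, and there they contribute factors
  1.\<close>

lemma det_eq_principal_minor:
  fixes K :: "real^'v::finite^'v"
  assumes "\<And>i j. j \<notin> D \<Longrightarrow> K $ i $ j = (if i = j then 1 else 0)"
  shows "det K = principal_minor K D"
proof -
  have "det K = (\<Sum>p | p permutes D. of_int (sign p) * (\<Prod>i\<in>UNIV. K $ i $ p i))"
    unfolding det_def
  proof (intro sum.mono_neutral_right ballI)
    fix p assume p: "p \<in> {p. p permutes UNIV} - {p. p permutes D}"
    then have pU: "p permutes UNIV" by simp
    with p obtain j where j: "j \<notin> D" "p j \<noteq> j"
      by (auto simp: permutes_def)
    \<comment> \<open>The zero factor sits where \<open>p\<close> meets column \<open>j\<close>: in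
      row \<open>inv p j\<close>, which is off the diagonal.\<close>
    have "p (inv p j) = j" using permutes_inverses[OF pU] by simp
    moreover from this j have "inv p j \<noteq> j" by metis
    ultimately have "K $ inv p j $ p (inv p j) = 0"
      using assms[OF j(1)] by simp
    then have "(\<Prod>i\<in>UNIV. K $ i $ p i) = 0" by (intro prod_zero) auto
    then show "of_int (sign p) * (\<Prod>i\<in>UNIV. K $ i $ p i) = 0" by simp
  qed (simp_all add: Collect_mono permutes_subset)
  also have "\<dots> = principal_minor K D"
    unfolding principal_minor_def
  proof (intro sum.cong refl arg_cong2[where f = "(*)"])
    fix p assume "p \<in> {p. p permutes D}"
    then show "(\<Prod>i\<in>UNIV. K $ i $ p i) = (\<Prod>i\<in>D. K $ i $ p i)"
      using assms by (intro prod.mono_neutral_right) (auto simp: permutes_def)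
  qed
  finally show ?thesis .
qed

text \<open>Replace the columns of \<open>Q\<close> indexed by \<open>D\<close> by unit vectors to
  get \<open>N\<close>. Then \<open>K ** N\<close> has the columns of \<open>K\<close> on
  \<open>D\<close> and unit columns elsewhere, so taking determinants of \<open>K\<close>,
  \<open>N\<close> and \<open>K ** N\<close> gives the identity.\<close>

lemma principal_minor_jacobi:
  fixes K Q :: "real^'v::finite^'v"
  assumes "K ** Q = mat 1"
  shows "principal_minor K D = det K * principal_minor Q (- D)"
proof -
  define N :: "real^'v^'v" where
    "N = (\<chi> i j. if j \<in> D then (if i = j then 1 else 0) else Q $ i $ j)"
  have KN: "(K ** N) $ i $ j = (if j \<in> D then K $ i $ j else if i = j then 1 else 0)" for i j
  proof (cases "j \<in> D")
    case True
    then have "K $ i $ k * N $ k $ j = (if k = j then K $ i $ j else 0)" for k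
      by (simp add: N_def)
    with True show ?thesis by (simp add: matrix_matrix_mult_def)
  next
    case False
    then have "(K ** N) $ i $ j = (K ** Q) $ i $ j"
      by (simp add: matrix_matrix_mult_def N_def)
    with False assms show ?thesis by (simp add: mat_def)
  qed
  have "det N = principal_minor N (- D)"
    by (rule det_eq_principal_minor) (simp add: N_def)
  also have "\<dots> = principal_minor Q (- D)"
    by (rule principal_minor_cong) (simp add: N_def)
  finally have N: "det N = principal_minor Q (- D)" .
  have "det (K ** N) = principal_minor (K ** N) D"
    by (rule det_eq_principal_minor) (simp add: KN)
  also have "\<dots> = principal_minor K D"
    by (rule principal_minor_cong) (simp add: KN)
  finally show ?thesis using N by (simp add: det_mul)
qed

text \<open>The submatrix on \<open>D\<close> padded by an identity block to full size, so that
  facts on \<open>det\<close>, products and invertibility of square matrices apply to principal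
  minors.\<close>

definition principal_extension :: "real^'v::finite^'v \<Rightarrow> 'v set \<Rightarrow> real^'v^'v" where
  "principal_extension K D =
     (\<chi> i j. if i \<in> D \<and> j \<in> D then K $ i $ j else if i = j then 1 else 0)"

lemma det_principal_extension: "det (principal_extension K D) = principal_minor K D"
proof -
  have "det (principal_extension K D) = principal_minor (principal_extension K D) D"
    by (rule det_eq_principal_minor) (simp add: principal_extension_def)
  also have "\<dots> = principal_minor K D"
    by (rule principal_minor_cong) (simp add: principal_extension_def)
  finally show ?thesis .
qed

text \<open>The padded matrix of a block diagonal submatrix is the product of the padded blocks, and
  \<open>det\<close> is multiplicative.\<close>

lemma principal_minor_block:
  fixes K :: "real^'v::finite^'v"
  assumes disj: "T \<inter> U = {}"
    and zero: "\<And>i j. i \<in> T \<Longrightarrow> j \<in> U \<Longrightarrow> K $ i $ j = 0 \<and> K $ j $ i = 0"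
  shows "principal_minor K (T \<union> U) = principal_minor K T * principal_minor K U"
proof -
  have "principal_extension K (T \<union> U) = principal_extension K T ** principal_extension K U"
  proof (simp add: vec_eq_iff matrix_matrix_mult_def, intro allI)
    fix i j
    let ?f = "\<lambda>k. principal_extension K T $ i $ k * principal_extension K U $ k $ j"
    show "principal_extension K (T \<union> U) $ i $ j = sum ?f UNIV"
    proof (cases "i \<in> T")
      case True
      \<comment> \<open>The left factor vanishes unless \<open>k\<close> is in \<open>T\<close>, and
        for such \<open>k\<close> row \<open>k\<close> of the right factor is a unit row.\<close>
      have "?f k = (if k = j then principal_extension K (T \<union> U) $ i $ j else 0)" for k
        using True disj zero by (auto simp: principal_extension_def)
      then show ?thesis by simp
    next
      case False
      \<comment> \<open>Here row \<open>i\<close> of the left factor is itself a unit row.\<close>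
      have "?f k = (if k = i then principal_extension K (T \<union> U) $ i $ j else 0)" for k
        using False disj zero by (auto simp: principal_extension_def)
      then show ?thesis by simp
    qed
  qed
  then show ?thesis
    by (metis det_mul det_principal_extension)
qed

section \<open>Positive definiteness and the inverse of the kernel\<close>

lemma positive_definite_principal_minor_nonzero:
  fixes K :: "real^'v::finite^'v"
  assumes "positive_definite K"
  shows "principal_minor K D \<noteq> 0"
proof -
  have "x = 0" if x: "principal_extension K D *v x = 0" for x :: "real^'v"
  proof (rule ccontr)
    assume "x \<noteq> 0"
    then have pos: "x \<bullet> (K *v x) > 0" using assms by (simp add: positive_definite_def)
    have 0: "(\<Sum>j\<in>UNIV. principal_extension K D $ i $ j * x $ j) = 0" for i
      using x by (simp add: matrix_vector_mult_def vec_eq_iff)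
    \<comment> \<open>Identity rows force a kernel vector to vanish off \<open>D\<close>. On
      \<open>D\<close>, the padded rows then act on \<open>x\<close> like the rows of
      \<open>K\<close>, so the quadratic form of \<open>K\<close> vanishes at
      \<open>x\<close>.\<close>
    have out: "x $ i = 0" if "i \<notin> D" for i
    proof -
      have "principal_extension K D $ i $ j * x $ j = (if i = j then x $ i else 0)" for j
        using that by (simp add: principal_extension_def)
      with 0[of i] show ?thesis by simp
    qed
    have "(K *v x) $ i = 0" if "i \<in> D" for i
    proof -
      have "(K *v x) $ i = (\<Sum>j\<in>UNIV. principal_extension K D $ i $ j * x $ j)"
        unfolding matrix_vector_mult_def
        using that out by (auto simp: principal_extension_def intro!: sum.cong)
      with 0 show ?thesis by simp
    qed
    then have "x $ i * (K *v x) $ i = 0" for i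
      using out by (cases "i \<in> D") auto
    then have "x \<bullet> (K *v x) = 0"
      unfolding inner_vec_def by (intro sum.neutral) simp
    with pos show False by simp
  qed
  then have "invertible (principal_extension K D)"
    by (simp add: invertible_left_inverse matrix_left_invertible_ker)
  then show ?thesis
    by (simp add: invertible_det_nz det_principal_extension)
qed

lemma symmetric_matrix_inv:
  fixes K :: "real^'v::finite^'v"
  assumes "transpose K = K" "invertible K"
  shows "matrix_inv K $ i $ j = matrix_inv K $ j $ i"
proof -
  let ?Q = "matrix_inv K"
  have inv: "K ** ?Q = mat 1" "?Q ** K = mat 1"
    using someI_ex[of "\<lambda>Q. K ** Q = mat 1 \<and> Q ** K = mat 1"] assms(2)
    by (auto simp: invertible_def matrix_inv_def)
  have "transpose ?Q = transpose ?Q ** (K ** ?Q)" by (simp add: inv)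
  also have "\<dots> = transpose (K ** ?Q) ** ?Q"
    by (simp add: matrix_mul_assoc matrix_transpose_mul assms(1))
  also have "\<dots> = ?Q" by (simp add: inv transpose_mat)
  finally have "transpose ?Q $ j $ i = ?Q $ j $ i" by simp
  then show ?thesis by (simp add: transpose_def)
qed

text \<open>By Jacobi's identity each minor becomes \<open>det K\<close> times a factor depending
  only on \<open>C\<close> and one depending only on \<open>D\<close>; both sides are then the same
  product.\<close>

lemma principal_minor_factorize:
  fixes K Q :: "real^'v::finite^'v"
  assumes inv: "K ** Q = mat 1"
    and TU: "T \<inter> U = {}" "- S = T \<union> U"
    and zero: "\<And>i j. i \<in> T \<Longrightarrow> j \<in> U \<Longrightarrow> Q $ i $ j = 0 \<and> Q $ j $ i = 0"
    and CD: "C \<subseteq> T" "D \<subseteq> U"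
  shows "principal_minor K (S \<union> (C \<union> D)) * principal_minor K S =
    principal_minor K (S \<union> C) * principal_minor K (S \<union> D)"
proof -
  have *: "principal_minor K (S \<union> (C' \<union> D')) =
    det K * (principal_minor Q (T - C') * principal_minor Q (U - D'))"
    if "C' \<subseteq> T" "D' \<subseteq> U" for C' D'
  proof -
    have "- (S \<union> (C' \<union> D')) = (T - C') \<union> (U - D')" using TU that by auto
    moreover have "principal_minor Q ((T - C') \<union> (U - D')) =
      principal_minor Q (T - C') * principal_minor Q (U - D')"
      using TU zero by (intro principal_minor_block) auto
    ultimately show ?thesis by (simp add: principal_minor_jacobi[OF inv])
  qed
  show ?thesis
    \<comment> \<open>The four minors correspond to the pairs \<open>(C, D)\<close>,
      \<open>({}, {})\<close>, \<open>(C, {})\<close> and \<open>({}, D)\<close>.\<close>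
    using *[OF CD] *[of "{}" "{}"] *[OF CD(1), of "{}"] *[OF _ CD(2), of "{}"]
    by simp
qed

section \<open>Graph separation\<close>

lemma separates_partition:
  assumes sep: "separates E S A B" and "A \<inter> S = {}" "B \<inter> S = {}"
  obtains T U where "T \<inter> U = {}" "- S = T \<union> U" "A \<subseteq> T" "B \<subseteq> U"
    "\<And>i j. i \<in> T \<Longrightarrow> j \<in> U \<Longrightarrow> \<not> E i j"
proof -
  define T where "T = {v. \<exists>p. graph_path E p \<and> hd p \<in> A \<and> last p = v \<and> set p \<inter> S = {}}"
  show ?thesis
  proof (rule that[of T "- S - T"])
    have "T \<inter> S = {}"
      by (fastforce simp: T_def graph_path_def dest: last_in_set)
    then show "- S = T \<union> (- S - T)" by auto
    show "A \<subseteq> T"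
    proof
      fix v assume "v \<in> A"
      then show "v \<in> T"
        using assms(2) unfolding T_def by (auto simp: graph_path_def intro!: exI[of _ "[v]"])
    qed
    show "B \<subseteq> - S - T"
      using sep assms(3) by (auto simp: T_def separates_def)
    show "\<not> E i j" if i: "i \<in> T" and j: "j \<in> - S - T" for i j
    proof
      assume e: "E i j"
      obtain p where p: "graph_path E p" "hd p \<in> A" "last p = i" "set p \<inter> S = {}"
        using i by (auto simp: T_def)
      show False
      \<comment> \<open>Paths have distinct vertices, so appending \<open>j\<close> is allowed only
        if it is new; otherwise \<open>p\<close> is cut off at \<open>j\<close>. Either way
        \<open>j\<close> is reachable from \<open>A\<close> while avoiding \<open>S\<close>.\<close>
      proof (cases "j \<in> set p")
        case True
        then obtain xs ys where xy: "p = xs @ j # ys" by (auto simp: in_set_conv_decomp)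
        have "graph_path E (xs @ [j])" "hd (xs @ [j]) \<in> A" "set (xs @ [j]) \<inter> S = {}"
          using p by (auto simp: xy graph_path_def successively_append_iff hd_append split: if_splits)
        then have "j \<in> T" unfolding T_def by (metis (mono_tags, lifting) last_snoc mem_Collect_eq)
        with j show False by simp
      next
        case False
        then have "graph_path E (p @ [j])" "hd (p @ [j]) \<in> A" "set (p @ [j]) \<inter> S = {}"
          using p e j by (auto simp: graph_path_def successively_append_iff)
        then have "j \<in> T" unfolding T_def by (metis (mono_tags, lifting) last_snoc mem_Collect_eq)
        with j show False by simp
      qed
    qed
  qed auto
qed

section \<open>Independence from inclusion events\<close>

definition all_ones :: "'v set \<Rightarrow> ('v \<Rightarrow> bool) set" where
  "all_ones C = {x. \<forall>v\<in>C. x v}"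

lemma all_ones_Int: "all_ones C \<inter> all_ones D = all_ones (C \<union> D)"
  by (auto simp: all_ones_def)

lemma Int_stable_all_ones: "Int_stable (all_ones ` Pow A)"
  by (rule Int_stableI) (auto simp: all_ones_Int)

text \<open>The events \<open>all_ones {v}\<close> and their complements determine each coordinate
  in \<open>A\<close>. As the type of binary vectors is finite, measurability of the restriction
  needs checking on singletons only.\<close>

lemma restrict_vimage_sigma_all_ones:
  fixes A :: "'v::finite set"
  shows "(\<lambda>x. restrict x A) -` Z \<in> sigma_sets UNIV (all_ones ` Pow A)"
proof -
  let ?M = "sigma UNIV (all_ones ` Pow A)"
  have coord: "{x. x v = b} \<in> sets ?M" if "v \<in> A" for v b
  proof -
    have "all_ones {v} \<in> sets ?M" using that by auto
    moreover from this have "space ?M - all_ones {v} \<in> sets ?M" by blast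
    moreover have "{x. x v = b} = (if b then all_ones {v} else space ?M - all_ones {v})"
      by (auto simp: all_ones_def)
    ultimately show ?thesis by simp
  qed
  have "(\<lambda>x. restrict x A) \<in> measurable ?M (count_space UNIV)"
  proof (subst measurable_count_space_eq2, simp, intro conjI ballI)
    fix y :: "'v \<Rightarrow> bool"
    show "(\<lambda>x. restrict x A) -` {y} \<inter> space ?M \<in> sets ?M"
    \<comment> \<open>\<open>restrict\<close> takes the value \<open>undefined\<close> outside
      \<open>A\<close>, so any other \<open>y\<close> has empty preimage.\<close>
    proof (cases "\<forall>v. v \<notin> A \<longrightarrow> y v = undefined")
      case True
      then have "(\<lambda>x. restrict x A) -` {y} \<inter> space ?M = space ?M \<inter> (\<Inter>v\<in>A. {x. x v = y v})"
        by (auto simp: fun_eq_iff restrict_def)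
      also have "\<dots> \<in> sets ?M"
      proof (cases "A = {}")
        case False
        then show ?thesis
          using coord by (intro sets.Int sets.top sets.finite_INT) auto
      qed (simp add: sigma_sets_top)
      finally show ?thesis .
    next
      case False
      then have "(\<lambda>x. restrict x A) -` {y} \<inter> space ?M = {}"
        by (auto simp: fun_eq_iff restrict_def)
      then show ?thesis by (simp add: sigma_sets.Empty)
    qed
  qed simp
  then have "(\<lambda>x. restrict x A) -` Z \<inter> space ?M \<in> sets ?M"
    by (rule measurable_sets) simp
  then show ?thesis by simp
qed

text \<open>The inclusion events form a pi-system on each side, so the product rule for them extends
  to the generated sigma-algebras, and these contain those of the two restrictions.\<close>

lemma indep_var_restrict_all_ones:
  fixes M :: "('v::finite \<Rightarrow> bool) measure"
  assumes "prob_space M" and M: "space M = UNIV" "sets M = UNIV"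
    and eq: "\<And>C D. C \<subseteq> A \<Longrightarrow> D \<subseteq> B \<Longrightarrow>
      measure M (all_ones (C \<union> D)) = measure M (all_ones C) * measure M (all_ones D)"
  shows "prob_space.indep_var M
    (count_space UNIV) (\<lambda>x. restrict x A) (count_space UNIV) (\<lambda>x. restrict x B)"
proof -
  interpret prob_space M by fact
  have "indep_set (all_ones ` Pow A) (all_ones ` Pow B)"
    using eq by (auto simp: indep_sets2_eq M all_ones_Int)
  then have "indep_set (sigma_sets UNIV (all_ones ` Pow A)) (sigma_sets UNIV (all_ones ` Pow B))"
    using indep_set_sigma_sets[OF _ Int_stable_all_ones Int_stable_all_ones] M by simp
  moreover have "sigma_sets UNIV {(\<lambda>x. restrict x A) -` Z \<inter> UNIV |Z. Z \<in> UNIV}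
      \<subseteq> sigma_sets UNIV (all_ones ` Pow A)" for A :: "'v set"
    using restrict_vimage_sigma_all_ones[of A] by (intro sigma_sets_mono) auto
  ultimately have "indep_set
      (sigma_sets UNIV {(\<lambda>x. restrict x A) -` Z \<inter> UNIV |Z. Z \<in> UNIV})
      (sigma_sets UNIV {(\<lambda>x. restrict x B) -` Z \<inter> UNIV |Z. Z \<in> UNIV})"
    by (simp add: indep_sets2_eq) blast
  then show ?thesis
    by (simp add: indep_var_eq M measurable_def)
qed

theorem proposition7:
  fixes M :: "'w measure" and Y :: "'w \<Rightarrow> 'v::finite set" and K :: "real^'v^'v"
    and P :: "('v \<Rightarrow> bool) measure"
  assumes "dpp M Y K"
    and "P = distr M (count_space UNIV) (binary_vector Y)"
  shows "globally_markov (csi_model P) (concentration_graph K)"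
proof -
  interpret M: prob_space M using assms(1) by (simp add: dpp_def)
  have Y: "Y \<in> measurable M (count_space UNIV)" and pd: "positive_definite K"
    and minor: "\<And>C. C \<noteq> {} \<Longrightarrow> measure M {\<omega> \<in> space M. C \<subseteq> Y \<omega>} = principal_minor K C"
    using assms(1) by (auto simp: dpp_def)
  have bv: "binary_vector Y \<in> measurable M (count_space UNIV)"
  proof -
    have "binary_vector Y = (\<lambda>s v. v \<in> s) \<circ> Y" by (auto simp: binary_vector_def fun_eq_iff)
    then show ?thesis using Y by (simp add: measurable_comp[where N = "count_space UNIV"])
  qed
  interpret P: prob_space P unfolding assms(2) by (rule M.prob_space_distr[OF bv])
  have P: "space P = UNIV" "sets P = UNIV" by (simp_all add: assms(2))
  have prob: "measure P (all_ones C) = principal_minor K C" for C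
  proof -
    have "binary_vector Y -` all_ones C \<inter> space M = {\<omega> \<in> space M. C \<subseteq> Y \<omega>}"
      by (auto simp: all_ones_def binary_vector_def)
    then have "measure P (all_ones C) = measure M {\<omega> \<in> space M. C \<subseteq> Y \<omega>}"
      by (simp add: assms(2) measure_distr[OF bv])
    \<comment> \<open>The defining property of a DPP covers non-empty \<open>C\<close>; for
      \<open>C = {}\<close> both sides are 1.\<close>
    then show ?thesis by (cases "C = {}") (simp_all add: minor M.prob_space)
  qed
  let ?Q = "matrix_inv K"
  have "det K \<noteq> 0"
    using positive_definite_principal_minor_nonzero[OF pd, of UNIV] by (simp add: principal_minor_UNIV)
  then have invK: "invertible K" by (simp add: invertible_det_nz)
  then have KQ: "K ** ?Q = mat 1"
    using someI_ex[of "\<lambda>Q. K ** Q = mat 1 \<and> Q ** K = mat 1"]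
    by (auto simp: invertible_def matrix_inv_def)
  have sym: "?Q $ i $ j = ?Q $ j $ i" for i j
    using pd invK by (intro symmetric_matrix_inv) (simp_all add: positive_definite_def)
  show ?thesis
    unfolding globally_markov_def
  proof (intro allI impI, elim conjE)
    fix A B S :: "'v set"
    assume disj: "disjnt A B" "disjnt A S" "disjnt B S"
      and sep: "separates (concentration_graph K) S A B"
    obtain T U where TU: "T \<inter> U = {}" "- S = T \<union> U" "A \<subseteq> T" "B \<subseteq> U"
      and edge: "\<And>i j. i \<in> T \<Longrightarrow> j \<in> U \<Longrightarrow> \<not> concentration_graph K i j"
      using separates_partition[OF sep] disj by (auto simp: disjnt_def)
    \<comment> \<open>Disjointness of \<open>T\<close> and \<open>U\<close> gives distinct
      \<open>i\<close> and \<open>j\<close>, so a missing edge means a zero entry; symmetry of the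
      inverse gives the transposed entry.\<close>
    have zero: "?Q $ i $ j = 0 \<and> ?Q $ j $ i = 0" if "i \<in> T" "j \<in> U" for i j
      using edge[OF that] that TU(1) sym by (auto simp: concentration_graph_def)
    have S0: "principal_minor K S \<noteq> 0"
      by (rule positive_definite_principal_minor_nonzero[OF pd])
    \<comment> \<open>The context has positive probability, so conditioning on it yields a
      probability measure.\<close>
    have S: "emeasure P (all_ones S) \<noteq> 0" "emeasure P (all_ones S) \<noteq> \<infinity>"
      using S0 measure_nonneg[of P "all_ones S"]
      by (simp_all add: P.emeasure_eq_measure prob)
    let ?N = "uniform_measure P (all_ones S)"
    interpret N: prob_space ?N by (rule prob_space_uniform_measure[OF S])
    have probN: "measure ?N (all_ones C) = principal_minor K (S \<union> C) / principal_minor K S" for C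
      by (subst measure_uniform_measure[OF S]) (simp_all add: P all_ones_Int prob)
    have "N.indep_var (count_space UNIV) (\<lambda>x. restrict x A) (count_space UNIV) (\<lambda>x. restrict x B)"
    proof (rule indep_var_restrict_all_ones[OF N.prob_space_axioms])
      fix C D assume "C \<subseteq> A" "D \<subseteq> B"
      \<comment> \<open>Dividing this identity by the square of \<open>principal_minor K S\<close>
        gives the product rule for the conditional inclusion probabilities.\<close>
      then have "principal_minor K (S \<union> (C \<union> D)) * principal_minor K S =
          principal_minor K (S \<union> C) * principal_minor K (S \<union> D)"
        using TU by (intro principal_minor_factorize[OF KQ TU(1,2) zero]) auto
      then show "measure ?N (all_ones (C \<union> D)) = measure ?N (all_ones C) * measure ?N (all_ones D)"
        unfolding probN using S0 by (simp add: field_simps)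
    qed (simp_all add: P)
    moreover have "context_measure P S = ?N"
      by (simp add: context_measure_def all_ones_def P)
    ultimately show "(A, B, S) \<in> csi_model P"
      using disj by (simp add: csi_model_def)
  qed
qed

end
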